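(* Let $g$ be a holomorphic self-map of the open unit disc $\mathbb{D}$ with a Denjoy--Wolff point $\zeta$ in $\mathbb{D}$. Then there is a neighbourhood $\mathcal{U}$ of $g$ in $\mathcal{H}(\mathbb{D})$ such that if $g_1,g_2,\dotsc$ belong to $\mathcal{U}$, then the right-composition sequence $G_n=g_1\circ g_2\circ\dotsb\circ g_n$, $n=1,2,\dotsc$, converges locally uniformly on $\mathbb{D}$ to a constant in $\mathbb{D}$.
   Context: $\mathbb{D}=\{z\in\mathbb{C}:|z|<1\}$. $\mathcal{H}(\mathbb{D})$ denotes the set of all holomorphic self-maps of $\mathbb{D}$ (holomorphic functions $\mathbb{D}\to\mathbb{D}$), with the subspace topology inherited from the space of all holomorphic maps $\mathbb{D}\to\mathbb{C}$ equipped with the compact-open topology (the topology of uniform convergence on compact subsets of $\mathbb{D}$). A holomorphic self-map $g$ of $\mathbb{D}$ has Denjoy--Wolff point $\zeta\in\overline{\mathbb{D}}$ if the sequence of iterates $g,g^2,g^3,\dotsc$ (where $g^n$ is the $n$-fold composition of $g$ with itself) converges locally uniformly on $\mathbb{D}$ to the constant $\zeta$. By the Denjoy--Wolff theorem, every holomorphic self-map of $\mathbb{D}$ other than the identity and the elliptic Möbius transformations fixing $\mathbb{D}$ (automorphisms of $\mathbb{D}$ conjugate by an automorphism of $\mathbb{D}$ to a rotation about $0$) has a Denjoy--Wolff point; if it lies in $\mathbb{D}$ it is a fixed point of the map. Locally uniform convergence on $\mathbb{D}$ means uniform convergence on compact subsets of $\mathbb{D}$ with respect to the Euclidean metric. 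*)

theory Defs
  imports "HOL-Complex_Analysis.Complex_Analysis"
begin

abbreviation unit_disc :: "complex set" where
  "unit_disc \<equiv> ball 0 1"

definition compact_open_topology :: "'a topology \<Rightarrow> 'b topology \<Rightarrow> ('a \<Rightarrow> 'b) topology" where
  "compact_open_topology X Y =
     topology_generated_by
       {{f. continuous_map X Y f \<and> f ` K \<subseteq> U} | K U. compactin X K \<and> openin Y U}"

lemma topspace_compact_open_topology:
  "topspace (compact_open_topology X Y) = {f. continuous_map X Y f}"
proof -
  have "{f. continuous_map X Y f} \<in>
      {{f. continuous_map X Y f \<and> f ` K \<subseteq> U} | K U. compactin X K \<and> openin Y U}"
    by (rule CollectI, rule exI[of _ "{}"], rule exI[of _ "{}"]) auto
  then show ?thesis
    unfolding compact_open_topology_def topology_generated_by_topspace by auto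
qed

(* Elements are total functions; as usual with holomorphic_on, their values off the disc are
   irrelevant: maps agreeing on the disc lie in the same open sets of the topologies below. *)
definition holomorphic_maps_on_disc :: "(complex \<Rightarrow> complex) topology" where
  "holomorphic_maps_on_disc =
     subtopology (compact_open_topology (top_of_set unit_disc) euclidean)
       {f. f holomorphic_on unit_disc}"

definition holomorphic_self_maps :: "(complex \<Rightarrow> complex) topology" where
  "holomorphic_self_maps =
     subtopology holomorphic_maps_on_disc {f. f ` unit_disc \<subseteq> unit_disc}"

lemma topspace_holomorphic_self_maps:
  "topspace holomorphic_self_maps =
     {f. f holomorphic_on unit_disc \<and> f ` unit_disc \<subseteq> unit_disc}"
  by (auto simp: holomorphic_self_maps_def holomorphic_maps_on_disc_def
      topspace_compact_open_topology holomorphic_on_imp_continuous_on)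

definition converges_locally_uniformly ::
    "(nat \<Rightarrow> complex \<Rightarrow> complex) \<Rightarrow> (complex \<Rightarrow> complex) \<Rightarrow> bool" where
  "converges_locally_uniformly F f \<longleftrightarrow>
     (\<forall>K. compact K \<and> K \<subseteq> unit_disc \<longrightarrow> uniform_limit K F f sequentially)"

definition is_Denjoy_Wolff_point :: "(complex \<Rightarrow> complex) \<Rightarrow> complex \<Rightarrow> bool" where
  "is_Denjoy_Wolff_point g \<zeta> \<longleftrightarrow>
     \<zeta> \<in> closure unit_disc \<and> converges_locally_uniformly (\<lambda>n. g ^^ n) (\<lambda>_. \<zeta>)"

(* right_composition g n = g 1 o g 2 o ... o g n; the value g 0 is never used. *)
primrec right_composition :: "(nat \<Rightarrow> complex \<Rightarrow> complex) \<Rightarrow> nat \<Rightarrow> complex \<Rightarrow> complex" where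
  "right_composition g 0 = id"
| "right_composition g (Suc n) = right_composition g n \<circ> g (Suc n)"

end

theory Submission
  imports Defs
begin

text \<open>
  Differentiating \<open>g ^^ n\<close> at its fixed point \<open>\<zeta>\<close> and letting \<open>n\<close> tend to infinity shows
  \<open>\<bar>g' \<zeta>\<bar> < 1\<close>. Hence \<open>g\<close> maps some closed Euclidean disc \<open>cball \<zeta> r\<close> into a strictly smaller
  concentric disc \<open>ball \<zeta> s\<close>. Mapping \<open>cball \<zeta> r\<close> into \<open>ball \<zeta> s\<close> is an open condition in the
  compact-open topology, and it defines the neighbourhood \<open>U\<close>.

  All members of \<open>U\<close> contract the hyperbolic metric of \<open>ball \<zeta> r\<close> by a common factor. This is
  used in the infinitesimal form due to Earle and Hamilton, which works with derivatives and
  Cauchy's estimate in place of distances and the Schwarz--Pick lemma: if \<open>f\<close> belongs to \<open>U\<close>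
  and \<open>w\<close> is a point of \<open>ball \<zeta> r\<close>, the amplified map
  \<open>z \<mapsto> f z + t (f z - f w)\<close> still maps \<open>ball \<zeta> r\<close> to itself for small \<open>t > 0\<close>, it takes the
  same value as \<open>f\<close> at \<open>w\<close>, and its derivative there is \<open>1 + t\<close> times larger. Amplifying every
  factor of \<open>G n = g 1 \<circ> \<dots> \<circ> g n\<close> along an orbit gives a self-map of \<open>ball \<zeta> r\<close> whose derivative
  at the starting point is \<open>(1 + t) ^ n\<close> times that of \<open>G n\<close>; Cauchy's estimate bounds it
  independently of \<open>n\<close>, so the derivatives of \<open>G n\<close> decay geometrically on \<open>ball \<zeta> s\<close>
  (\<open>deriv_right_composition_bound\<close>). Since \<open>G (n + 1) \<zeta> = G n (g (n + 1) \<zeta>)\<close> with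
  \<open>g (n + 1) \<zeta>\<close> in \<open>ball \<zeta> s\<close>, the sequence \<open>G n \<zeta>\<close> is Cauchy, and \<open>G n\<close> converges to a constant
  on \<open>ball \<zeta> s\<close>. Montel's theorem and the identity theorem carry this convergence over to the
  whole unit disc.
\<close>

section \<open>Geometric decay of the derivatives\<close>

lemma right_composition_self_map:
  assumes "\<And>k. k \<ge> 1 \<Longrightarrow> gs k holomorphic_on S" and "\<And>k. k \<ge> 1 \<Longrightarrow> gs k ` S \<subseteq> S"
  shows "right_composition gs n holomorphic_on S" and "right_composition gs n ` S \<subseteq> S"
proof -
  have "right_composition gs n holomorphic_on S \<and> right_composition gs n ` S \<subseteq> S"
  proof (induction n)
    case (Suc n)
    have "gs (Suc n) holomorphic_on S" "gs (Suc n) ` S \<subseteq> S"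
      using assms[of "Suc n"] by auto
    with Suc show ?case
      by (auto simp del: o_apply intro!: holomorphic_on_compose_gen[where t = S]) auto
  qed (auto simp: id_def)
  then show "right_composition gs n holomorphic_on S" "right_composition gs n ` S \<subseteq> S"
    by auto
qed

text \<open>
  Each factor \<open>f\<close> is amplified about the point where the orbit of \<open>w\<close> meets it. This leaves the
  orbit unchanged, so the chain rule multiplies the amplification factors of the derivatives.

  The amplification factor is \<open>1 + t\<close> with \<open>t = (r - s) / (2 * s)\<close>: two points of \<open>ball \<zeta> s\<close> have
  distance less than \<open>2 * s\<close>, so \<open>f z + t (f z - f w)\<close> stays within \<open>s + 2 * s * t = r\<close> of \<open>\<zeta>\<close>.
\<close>

lemma amplified_right_composition:
  fixes \<zeta> :: complex
  assumes s: "0 < s" "s < r"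
    and hol: "\<And>k. k \<ge> 1 \<Longrightarrow> gs k holomorphic_on ball \<zeta> r"
    and sub: "\<And>k. k \<ge> 1 \<Longrightarrow> gs k ` ball \<zeta> r \<subseteq> ball \<zeta> s"
    and w: "w \<in> ball \<zeta> r"
  shows "\<exists>H. H holomorphic_on ball \<zeta> r \<and> H ` ball \<zeta> r \<subseteq> ball \<zeta> r \<and>
           deriv H w = of_real (((r + s) / (2 * s)) ^ n) * deriv (right_composition gs n) w"
  using w
proof (induction n arbitrary: w)
  case 0
  show ?case
    by (rule exI[of _ id]) (auto simp: id_def)
next
  case (Suc n)
  define f where "f = gs (Suc n)"
  define t where "t = (r - s) / (2 * s)"
  define \<kappa> where "\<kappa> = (r + s) / (2 * s)"
  have t: "t > 0" and ts: "s + t * (2 * s) = r" and \<kappa>: "\<kappa> = 1 + t"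
    using s by (auto simp: t_def \<kappa>_def field_simps)
  have f_hol: "f holomorphic_on ball \<zeta> r" and f_sub: "f ` ball \<zeta> r \<subseteq> ball \<zeta> s"
    using hol[of "Suc n"] sub[of "Suc n"] by (auto simp: f_def)
  have fw: "f w \<in> ball \<zeta> s"
    using f_sub Suc.prems by blast
  then have fw': "f w \<in> ball \<zeta> r"
    using s by auto
  obtain H where H: "H holomorphic_on ball \<zeta> r" "H ` ball \<zeta> r \<subseteq> ball \<zeta> r"
      "deriv H (f w) = of_real (\<kappa> ^ n) * deriv (right_composition gs n) (f w)"
    using Suc.IH[OF fw'] unfolding \<kappa>_def by blast
  define h where "h = (\<lambda>z. f z + of_real t * (f z - f w))"
  have h_hol: "h holomorphic_on ball \<zeta> r"
    unfolding h_def by (intro holomorphic_intros f_hol)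
  have h_sub: "h ` ball \<zeta> r \<subseteq> ball \<zeta> r"
  proof (rule image_subsetI)
    fix z assume "z \<in> ball \<zeta> r"
    then have fz: "dist \<zeta> (f z) < s"
      using f_sub mem_ball by blast
    have "cmod (f z - f w) \<le> 2 * s"
      using fz fw dist_triangle3[of "f z" "f w" \<zeta>] by (simp add: dist_norm)
    then have "t * cmod (f z - f w) \<le> t * (2 * s)"
      using t by (intro mult_left_mono) auto
    then have "dist (f z) (h z) \<le> t * (2 * s)"
      using t by (simp add: h_def dist_norm norm_mult)
    with fz show "h z \<in> ball \<zeta> r"
      using dist_triangle[of \<zeta> "h z" "f z"] ts by simp
  qed
  have f_diff: "f field_differentiable at w"
    using f_hol Suc.prems holomorphic_on_imp_differentiable_at open_ball by blast
  have "(h has_field_derivative of_real \<kappa> * deriv f w) (at w)"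
    unfolding h_def \<kappa> using f_diff[unfolded DERIV_deriv_iff_field_differentiable[symmetric]]
    by (auto intro!: derivative_eq_intros simp: algebra_simps)
  then have h_deriv: "deriv h w = of_real \<kappa> * deriv f w"
    by (rule DERIV_imp_deriv)
  have hw: "h w = f w"
    by (simp add: h_def)
  have gs_r: "gs k ` ball \<zeta> r \<subseteq> ball \<zeta> r" if "k \<ge> 1" for k
    using sub[OF that] s by force
  have R_hol: "right_composition gs n holomorphic_on ball \<zeta> r"
    using right_composition_self_map(1)[of gs "ball \<zeta> r"] hol gs_r by blast
  have "deriv (H \<circ> h) w = deriv H (f w) * deriv h w"
    using deriv_chain[of h w H] h_hol H(1) hw fw' Suc.prems
      holomorphic_on_imp_differentiable_at open_ball by metis
  moreover have "deriv (right_composition gs n \<circ> f) w =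
      deriv (right_composition gs n) (f w) * deriv f w"
    using deriv_chain[OF f_diff] R_hol fw' holomorphic_on_imp_differentiable_at open_ball by blast
  ultimately have "deriv (H \<circ> h) w = of_real (\<kappa> ^ Suc n) * deriv (right_composition gs (Suc n)) w"
    using H(3) h_deriv by (simp add: f_def)
  moreover have "H \<circ> h holomorphic_on ball \<zeta> r"
    using h_hol H(1) h_sub by (rule holomorphic_on_compose_gen)
  moreover have "(H \<circ> h) ` ball \<zeta> r \<subseteq> ball \<zeta> r"
    using H(2) h_sub by auto
  ultimately show ?case
    unfolding \<kappa>_def by blast
qed

lemma deriv_right_composition_bound:
  fixes \<zeta> :: complex
  assumes s: "0 < s" "s < r"
    and hol: "\<And>k. k \<ge> 1 \<Longrightarrow> gs k holomorphic_on ball \<zeta> r"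
    and sub: "\<And>k. k \<ge> 1 \<Longrightarrow> gs k ` ball \<zeta> r \<subseteq> ball \<zeta> s"
    and w: "w \<in> ball \<zeta> s"
  shows "cmod (deriv (right_composition gs n) w) \<le> 2 * r / (r - s) * (2 * s / (r + s)) ^ n"
proof -
  have "w \<in> ball \<zeta> r"
    using w s by auto
  then obtain H where H: "H holomorphic_on ball \<zeta> r" "H ` ball \<zeta> r \<subseteq> ball \<zeta> r"
      "deriv H w = of_real (((r + s) / (2 * s)) ^ n) * deriv (right_composition gs n) w"
    using amplified_right_composition[of s r gs \<zeta> w n] s hol sub by blast
  \<comment> \<open>Half the distance from \<open>ball \<zeta> s\<close> to the boundary of \<open>ball \<zeta> r\<close>, so that the closed disc of
    this radius about \<open>w\<close> lies in \<open>ball \<zeta> r\<close>.\<close>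
  define \<rho> where "\<rho> = (r - s) / 2"
  have \<rho>: "\<rho> > 0"
    using s by (simp add: \<rho>_def)
  have cb: "cball w \<rho> \<subseteq> ball \<zeta> r"
  proof
    fix x assume "x \<in> cball w \<rho>"
    then have "dist \<zeta> x < s + \<rho>"
      using w dist_triangle[of \<zeta> x w] by simp
    also have "\<dots> \<le> r"
      using s by (simp add: \<rho>_def field_simps)
    finally show "x \<in> ball \<zeta> r"
      by simp
  qed
  have "cmod ((deriv ^^ 1) H w) \<le> fact 1 * r / \<rho> ^ 1"
  proof (rule Cauchy_higher_deriv_bound)
    show "H holomorphic_on ball w \<rho>"
      using H(1) cb ball_subset_cball holomorphic_on_subset by blast
    show "continuous_on (cball w \<rho>) H"
      using H(1) cb holomorphic_on_imp_continuous_on continuous_on_subset by blast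
    show "H x \<in> ball \<zeta> r" if "x \<in> ball w \<rho>" for x
      using that cb H(2) ball_subset_cball by blast
  qed (use \<rho> in auto)
  then have "cmod (deriv H w) \<le> 2 * r / (r - s)"
    by (simp add: \<rho>_def mult.commute)
  moreover have "cmod (deriv H w) =
      ((r + s) / (2 * s)) ^ n * cmod (deriv (right_composition gs n) w)"
    unfolding H(3) norm_mult norm_of_real using s by simp
  ultimately have "((r + s) / (2 * s)) ^ n * cmod (deriv (right_composition gs n) w)
      \<le> 2 * r / (r - s)"
    by simp
  then show ?thesis
    using s by (simp add: power_divide field_simps)
qed

section \<open>Convergence near the fixed point\<close>

lemma right_composition_tendsto_on_ball:
  fixes \<zeta> :: complex
  assumes s: "0 < s" "s < r"
    and hol: "\<And>k. k \<ge> 1 \<Longrightarrow> gs k holomorphic_on ball \<zeta> r"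
    and sub: "\<And>k. k \<ge> 1 \<Longrightarrow> gs k ` ball \<zeta> r \<subseteq> ball \<zeta> s"
  obtains c where "c \<in> cball \<zeta> s"
    and "\<And>z. z \<in> ball \<zeta> s \<Longrightarrow> (\<lambda>n. right_composition gs n z) \<longlonglongrightarrow> c"
proof -
  define G where "G = right_composition gs"
  define q where "q = 2 * s / (r + s)"
  define C where "C = 2 * r / (r - s)"
  have q: "0 \<le> q" "q < 1" and C: "0 \<le> C"
    using s by (auto simp: q_def C_def)
  have gs_r: "gs k ` ball \<zeta> r \<subseteq> ball \<zeta> r" if "k \<ge> 1" for k
    using sub[OF that] s by force
  have gs_s: "gs k ` ball \<zeta> s \<subseteq> ball \<zeta> s" if "k \<ge> 1" for k
    using sub[OF that] s by force
  have G_hol: "G n holomorphic_on ball \<zeta> r" for n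
    unfolding G_def using right_composition_self_map(1)[of gs "ball \<zeta> r"] hol gs_r by blast
  have hol_s: "gs k holomorphic_on ball \<zeta> s" if "k \<ge> 1" for k
    using hol[OF that] s by (auto intro: holomorphic_on_subset)
  have G_sub: "G n ` ball \<zeta> s \<subseteq> ball \<zeta> s" for n
    unfolding G_def using right_composition_self_map(2)[of gs "ball \<zeta> s"] hol_s gs_s by blast
  have osc: "cmod (G n z - G n \<zeta>) \<le> C * s * q ^ n" if z: "z \<in> ball \<zeta> s" for n z
  proof -
    have "cmod (G n z - G n \<zeta>) \<le> C * q ^ n * cmod (z - \<zeta>)"
    proof (rule field_differentiable_bound)
      fix x assume x: "x \<in> ball \<zeta> s"
      then have "x \<in> ball \<zeta> r"
        using s by auto
      then show "(G n has_field_derivative deriv (G n) x) (at x within ball \<zeta> s)"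
        using G_hol holomorphic_derivI open_ball by blast
      show "cmod (deriv (G n) x) \<le> C * q ^ n"
        unfolding G_def C_def q_def by (rule deriv_right_composition_bound[OF s hol sub x])
    qed (use z s in auto)
    also have "\<dots> \<le> C * q ^ n * s"
      using z q C by (intro mult_left_mono) (auto simp: dist_norm norm_minus_commute)
    finally show ?thesis
      by (simp add: mult_ac)
  qed
  have geometric: "summable (\<lambda>n. C * s * q ^ n)"
    using q by (intro summable_mult summable_geometric) auto
  have "cmod (G (Suc n) \<zeta> - G n \<zeta>) \<le> C * s * q ^ n" for n
    using osc[of "gs (Suc n) \<zeta>" n] gs_s[of "Suc n"] s by (force simp: G_def)
  then have "summable (\<lambda>n. G (Suc n) \<zeta> - G n \<zeta>)"
    by (intro summable_comparison_test'[OF geometric])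
  then obtain l where "(\<lambda>n. G (Suc n) \<zeta> - G n \<zeta>) sums l"
    by (auto simp: summable_def)
  then have "(\<lambda>n. G n \<zeta> - G 0 \<zeta>) \<longlonglongrightarrow> l"
    unfolding sums_def sum_lessThan_telescope[of "\<lambda>n. G n \<zeta>"] .
  then have lim: "(\<lambda>n. G n \<zeta>) \<longlonglongrightarrow> l + G 0 \<zeta>"
    using tendsto_add[OF _ tendsto_const[of "G 0 \<zeta>"]] by fastforce
  show ?thesis
  proof (rule that)
    have "G n \<zeta> \<in> cball \<zeta> s" for n
      using subsetD[OF G_sub imageI, of \<zeta> n] s by simp
    then show "l + G 0 \<zeta> \<in> cball \<zeta> s"
      by (rule closed_sequentially[OF closed_cball _ lim])
    fix z assume "z \<in> ball \<zeta> s"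
    then have "(\<lambda>n. G n z - G n \<zeta>) \<longlonglongrightarrow> 0"
      using osc by (intro Lim_null_comparison[OF _ summable_LIMSEQ_zero[OF geometric]]) auto
    from tendsto_add[OF this lim] show "(\<lambda>n. right_composition gs n z) \<longlonglongrightarrow> l + G 0 \<zeta>"
      by (simp add: G_def)
  qed
qed

section \<open>From a small disc to the unit disc\<close>

text \<open>
  A special case of Vitali's theorem. If the convergence on some compact set failed to be uniform,
  a subsequence would stay away from \<open>c\<close> there. By Montel's theorem it has a locally uniform
  subsequential limit, which is \<open>c\<close> on \<open>V\<close> and hence everywhere by the identity theorem.
\<close>

lemma locally_uniform_if_tendsto_const_on_open:
  assumes hol: "\<And>n. G n holomorphic_on unit_disc"
    and sub: "\<And>n. G n ` unit_disc \<subseteq> unit_disc"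
    and V: "open V" "V \<noteq> {}" "V \<subseteq> unit_disc"
    and lim: "\<And>z. z \<in> V \<Longrightarrow> (\<lambda>n. G n z) \<longlonglongrightarrow> c"
  shows "converges_locally_uniformly G (\<lambda>_. c)"
  unfolding converges_locally_uniformly_def
proof (intro allI impI, rule ccontr)
  fix K assume K: "compact K \<and> K \<subseteq> unit_disc" and "\<not> uniform_limit K G (\<lambda>_. c) sequentially"
  then obtain e where e: "e > 0" and "\<And>N. \<exists>n\<ge>N. \<exists>x\<in>K. dist (G n x) c \<ge> e"
    unfolding uniform_limit_sequentially_iff by (meson not_less)
  then have "\<exists>\<^sub>\<infinity>n. \<exists>x\<in>K. dist (G n x) c \<ge> e"
    by (simp add: INFM_nat_le)
  then have inf: "infinite {n. \<exists>x\<in>K. dist (G n x) c \<ge> e}"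
    by (simp add: INFM_iff_infinite)
  define \<sigma> where "\<sigma> = enumerate {n. \<exists>x\<in>K. dist (G n x) c \<ge> e}"
  have \<sigma>: "strict_mono \<sigma>" and away: "\<And>n. \<exists>x\<in>K. dist (G (\<sigma> n) x) c \<ge> e"
    using inf strict_mono_enumerate[OF inf] enumerate_in_set[OF inf] by (auto simp: \<sigma>_def)
  obtain \<phi> \<tau> where \<phi>: "\<phi> holomorphic_on unit_disc" and \<tau>: "strict_mono (\<tau> :: nat \<Rightarrow> nat)"
    and pointwise: "\<And>x. x \<in> unit_disc \<Longrightarrow> (\<lambda>n. G (\<sigma> (\<tau> n)) x) \<longlonglongrightarrow> \<phi> x"
    and unif: "\<And>K. compact K \<Longrightarrow> K \<subseteq> unit_disc \<Longrightarrow>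
      uniform_limit K ((\<lambda>n. G (\<sigma> n)) \<circ> \<tau>) \<phi> sequentially"
  proof (rule Montel[of unit_disc "range G" "\<lambda>n. G (\<sigma> n)"])
    show "\<exists>B. \<forall>h\<in>range G. \<forall>z\<in>L. cmod (h z) \<le> B" if "L \<subseteq> unit_disc" for L
    proof (intro exI[of _ 1] ballI)
      fix h z assume "h \<in> range G" "z \<in> L"
      then have "h z \<in> unit_disc"
        using that sub by blast
      then show "cmod (h z) \<le> 1"
        by simp
    qed
  qed (use hol in auto)
  have "\<phi> z = c" if "z \<in> V" for z
  proof (rule LIMSEQ_unique)
    show "(\<lambda>n. G (\<sigma> (\<tau> n)) z) \<longlonglongrightarrow> \<phi> z"
      using pointwise that V(3) by blast
    show "(\<lambda>n. G (\<sigma> (\<tau> n)) z) \<longlonglongrightarrow> c"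
      using LIMSEQ_subseq_LIMSEQ[OF lim[OF that] strict_mono_o[OF \<sigma> \<tau>]] by (simp add: o_def)
  qed
  then have \<phi>_c: "\<phi> z = c" if "z \<in> unit_disc" for z
    using analytic_continuation_open[of V unit_disc \<phi> "\<lambda>_. c" z] V \<phi> that
    by (auto simp: connected_ball)
  have "\<exists>N. \<forall>n\<ge>N. \<forall>x\<in>K. dist (G (\<sigma> (\<tau> n)) x) (\<phi> x) < e"
    using unif K e unfolding uniform_limit_sequentially_iff by (simp add: o_def)
  then obtain N where "\<forall>x\<in>K. dist (G (\<sigma> (\<tau> N)) x) (\<phi> x) < e"
    by blast
  with away[of "\<tau> N"] \<phi>_c K show False
    by (metis not_less subsetD)
qed

section \<open>The neighbourhood\<close>

lemma openin_holomorphic_self_maps_subbasic: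
  assumes "compact K" "K \<subseteq> unit_disc" "open V"
  shows "openin holomorphic_self_maps {f \<in> topspace holomorphic_self_maps. f ` K \<subseteq> V}"
proof -
  have "openin (compact_open_topology (top_of_set unit_disc) euclidean)
      {f. continuous_map (top_of_set unit_disc) euclidean f \<and> f ` K \<subseteq> V}"
    unfolding compact_open_topology_def using assms
    by (intro topology_generated_by_Basis CollectI exI[of _ K] exI[of _ V])
      (auto simp: compactin_subtopology)
  moreover have "{f \<in> topspace holomorphic_self_maps. f ` K \<subseteq> V} =
      {f. continuous_map (top_of_set unit_disc) euclidean f \<and> f ` K \<subseteq> V} \<inter>
        {f. f holomorphic_on unit_disc} \<inter> {f. f ` unit_disc \<subseteq> unit_disc}"
    by (auto simp: topspace_holomorphic_self_maps holomorphic_on_imp_continuous_on)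
  ultimately show ?thesis
    unfolding holomorphic_self_maps_def holomorphic_maps_on_disc_def
    by (simp add: openin_subtopology_Int)
qed

lemma Denjoy_Wolff_point_fixed:
  assumes g: "g \<in> topspace holomorphic_self_maps"
    and dw: "is_Denjoy_Wolff_point g \<zeta>" and \<zeta>: "\<zeta> \<in> unit_disc"
  shows "g \<zeta> = \<zeta>"
proof (rule LIMSEQ_unique)
  have "compact {\<zeta>} \<and> {\<zeta>} \<subseteq> unit_disc"
    using \<zeta> by simp
  then have "uniform_limit {\<zeta>} (\<lambda>n. g ^^ n) (\<lambda>_. \<zeta>) sequentially"
    using dw unfolding is_Denjoy_Wolff_point_def converges_locally_uniformly_def by metis
  then have lim: "(\<lambda>n. (g ^^ n) \<zeta>) \<longlonglongrightarrow> \<zeta>"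
    by (rule tendsto_uniform_limitI) simp
  have "isCont g \<zeta>"
    using g \<zeta> holomorphic_on_imp_continuous_on[of g unit_disc]
      continuous_on_eq_continuous_at[of unit_disc g]
    by (simp add: topspace_holomorphic_self_maps)
  from isCont_tendsto_compose[OF this lim]
  show "(\<lambda>n. (g ^^ Suc n) \<zeta>) \<longlonglongrightarrow> g \<zeta>"
    by simp
  show "(\<lambda>n. (g ^^ Suc n) \<zeta>) \<longlonglongrightarrow> \<zeta>"
    using lim by (rule LIMSEQ_Suc)
qed

text \<open>
  By the chain rule at the fixed point, the derivative of \<open>g ^^ n\<close> there is the \<open>n\<close>-th power of the
  multiplier \<open>g' \<zeta>\<close>; it tends to the derivative of a constant, so the multiplier has modulus less
  than one.
\<close>

lemma Denjoy_Wolff_multiplier_less_1: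
  assumes g: "g \<in> topspace holomorphic_self_maps"
    and dw: "is_Denjoy_Wolff_point g \<zeta>" and \<zeta>: "\<zeta> \<in> unit_disc"
  shows "cmod (deriv g \<zeta>) < 1"
proof -
  have g_hol: "g holomorphic_on unit_disc" and g_sub: "g ` unit_disc \<subseteq> unit_disc"
    using g by (auto simp: topspace_holomorphic_self_maps)
  have fixed: "g \<zeta> = \<zeta>"
    using assms by (rule Denjoy_Wolff_point_fixed)
  have "g ^^ n = right_composition (\<lambda>_. g) n" for n
    by (induction n) (simp_all add: funpow_Suc_right del: funpow.simps(2))
  then have iter: "(g ^^ n) holomorphic_on unit_disc" for n
    using right_composition_self_map(1)[of "\<lambda>_. g" unit_disc n] g_hol g_sub by simp
  have iter_fixed: "(g ^^ n) \<zeta> = \<zeta>" for n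
    by (induction n) (auto simp: fixed)
  have deriv_iter: "deriv (g ^^ n) \<zeta> = deriv g \<zeta> ^ n" for n
  proof (induction n)
    case (Suc n)
    have "deriv (g \<circ> g ^^ n) \<zeta> = deriv g \<zeta> * deriv (g ^^ n) \<zeta>"
      using deriv_chain[of "g ^^ n" \<zeta> g] iter g_hol \<zeta> iter_fixed
        holomorphic_on_imp_differentiable_at open_ball by metis
    then show ?case
      using Suc by (simp del: o_apply)
  qed (simp add: id_def)
  obtain \<rho> where \<rho>: "\<rho> > 0" "cball \<zeta> \<rho> \<subseteq> unit_disc"
    using \<zeta> open_ball open_contains_cball by blast
  have "uniform_limit (cball \<zeta> \<rho>) (\<lambda>n. g ^^ n) (\<lambda>_. \<zeta>) sequentially"
    using dw \<rho> by (auto simp: is_Denjoy_Wolff_point_def converges_locally_uniformly_def)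
  then have "uniform_limit (ball \<zeta> \<rho>) (\<lambda>n. g ^^ n) (\<lambda>_. \<zeta>) sequentially"
    by (rule uniform_limit_on_subset) auto
  then have "(\<lambda>n. deriv (g ^^ n) \<zeta>) \<longlonglongrightarrow> deriv (\<lambda>_. \<zeta>) \<zeta>"
  proof (rule deriv_complex_uniform_limit)
    show "\<forall>\<^sub>F n in sequentially. (g ^^ n) holomorphic_on ball \<zeta> \<rho>"
      using iter \<rho> ball_subset_cball holomorphic_on_subset by (intro always_eventually) blast
  qed (use \<rho> in auto)
  then have "(\<lambda>n. deriv g \<zeta> ^ n) \<longlonglongrightarrow> 0"
    by (simp add: deriv_iter)
  then have "\<forall>\<^sub>F n in sequentially. dist (deriv g \<zeta> ^ n) 0 < 1"
    by (rule tendstoD) simp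
  then have "\<forall>\<^sub>F n in sequentially. cmod (deriv g \<zeta>) ^ n < 1"
    by (simp add: norm_power)
  then obtain n where "cmod (deriv g \<zeta>) ^ n < 1"
    by (auto simp: eventually_sequentially)
  then show ?thesis
    using one_le_power[of "cmod (deriv g \<zeta>)" n] by linarith
qed

lemma attracting_fixed_point_trapping_discs:
  fixes g :: "complex \<Rightarrow> complex"
  assumes S: "open S" "\<zeta> \<in> S" and g: "g holomorphic_on S"
    and fixed: "g \<zeta> = \<zeta>" and attracting: "cmod (deriv g \<zeta>) < 1"
  obtains r s where "0 < s" "s < r" "cball \<zeta> r \<subseteq> S" "g ` cball \<zeta> r \<subseteq> ball \<zeta> s"
proof -
  \<comment> \<open>\<open>k\<close> bounds the difference quotients near \<open>\<zeta>\<close>; \<open>m\<close> leaves room between \<open>k\<close> and \<open>1\<close>, so that the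
    image of the closed disc of radius \<open>r\<close> lies in the open disc of radius \<open>m * r < r\<close>.\<close>
  obtain k where k: "cmod (deriv g \<zeta>) < k" "k < 1"
    using attracting dense by blast
  obtain m where m: "k < m" "m < 1"
    using k dense by blast
  have "k > 0"
    using k(1) norm_ge_zero[of "deriv g \<zeta>"] by linarith
  have "(g has_field_derivative deriv g \<zeta>) (at \<zeta>)"
    using g S holomorphic_derivI by blast
  then have "((\<lambda>z. cmod ((g z - g \<zeta>) / (z - \<zeta>))) \<longlongrightarrow> cmod (deriv g \<zeta>)) (at \<zeta>)"
    by (intro tendsto_norm) (simp add: has_field_derivative_iff)
  then have "\<forall>\<^sub>F z in at \<zeta>. cmod ((g z - g \<zeta>) / (z - \<zeta>)) < k"
    using k(1) by (rule order_tendstoD)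
  then obtain d where d: "d > 0"
    and quot: "\<And>z. z \<noteq> \<zeta> \<Longrightarrow> dist z \<zeta> < d \<Longrightarrow> cmod ((g z - g \<zeta>) / (z - \<zeta>)) < k"
    unfolding eventually_at by auto
  obtain e where e: "e > 0" "cball \<zeta> e \<subseteq> S"
    using S open_contains_cball by blast
  define r where "r = min e (d / 2)"
  have r: "0 < r" "r \<le> e" "r < d"
    using d e by (auto simp: r_def)
  show ?thesis
  proof (rule that[of "m * r" r])
    show "0 < m * r" "m * r < r"
      using r m \<open>k > 0\<close> by auto
    show "cball \<zeta> r \<subseteq> S"
      using e r by (meson order_trans subset_cball)
    show "g ` cball \<zeta> r \<subseteq> ball \<zeta> (m * r)"
    proof (rule image_subsetI)
      fix z assume z: "z \<in> cball \<zeta> r"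
      have "cmod (g z - \<zeta>) \<le> k * cmod (z - \<zeta>)"
      proof (cases "z = \<zeta>")
        case False
        then show ?thesis
          using quot[of z] z r fixed
          by (simp add: dist_commute norm_divide divide_less_eq split: if_splits)
      qed (simp add: fixed)
      also have "\<dots> \<le> k * r"
        using z \<open>k > 0\<close> by (intro mult_left_mono) (auto simp: dist_norm norm_minus_commute)
      also have "\<dots> < m * r"
        using m r by simp
      finally show "g z \<in> ball \<zeta> (m * r)"
        by (simp add: dist_norm norm_minus_commute)
    qed
  qed
qed

theorem theorem3p1:
  fixes g :: "complex \<Rightarrow> complex" and \<zeta> :: complex
  assumes "g \<in> topspace holomorphic_self_maps"
    and "is_Denjoy_Wolff_point g \<zeta>"
    and "\<zeta> \<in> unit_disc"
  shows "\<exists>U. openin holomorphic_self_maps U \<and> g \<in> U \<and>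
           (\<forall>gs :: nat \<Rightarrow> complex \<Rightarrow> complex. (\<forall>n\<ge>1. gs n \<in> U) \<longrightarrow>
              (\<exists>c\<in>unit_disc. converges_locally_uniformly (right_composition gs) (\<lambda>_. c)))"
proof -
  have "g holomorphic_on unit_disc"
    using assms(1) by (simp add: topspace_holomorphic_self_maps)
  then obtain r s where s: "0 < s" "s < r" and r: "cball \<zeta> r \<subseteq> unit_disc"
    and trap: "g ` cball \<zeta> r \<subseteq> ball \<zeta> s"
    by (rule attracting_fixed_point_trapping_discs[OF open_ball assms(3) _
          Denjoy_Wolff_point_fixed[OF assms] Denjoy_Wolff_multiplier_less_1[OF assms]])
  define U where "U = {f \<in> topspace holomorphic_self_maps. f ` cball \<zeta> r \<subseteq> ball \<zeta> s}"
  have s_disc: "cball \<zeta> s \<subseteq> unit_disc"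
    using r s by (meson less_imp_le order_trans subset_cball)
  show ?thesis
  proof (intro exI[of _ U] conjI allI impI)
    show "openin holomorphic_self_maps U"
      unfolding U_def using r by (intro openin_holomorphic_self_maps_subbasic) auto
    show "g \<in> U"
      using assms(1) trap by (simp add: U_def)
    fix gs :: "nat \<Rightarrow> complex \<Rightarrow> complex"
    assume gs: "\<forall>n\<ge>1. gs n \<in> U"
    then have hol: "gs k holomorphic_on unit_disc" and self: "gs k ` unit_disc \<subseteq> unit_disc"
      and "gs k ` cball \<zeta> r \<subseteq> ball \<zeta> s" if "k \<ge> 1" for k
      using that by (simp_all add: U_def topspace_holomorphic_self_maps)
    then have gs_trap: "gs k ` ball \<zeta> r \<subseteq> ball \<zeta> s" if "k \<ge> 1" for k
      using that by (meson ball_subset_cball image_mono order_trans)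
    have hol_r: "gs k holomorphic_on ball \<zeta> r" if "k \<ge> 1" for k
      using hol[OF that] r ball_subset_cball holomorphic_on_subset by blast
    obtain c where c: "c \<in> cball \<zeta> s"
      and lim: "\<And>z. z \<in> ball \<zeta> s \<Longrightarrow> (\<lambda>n. right_composition gs n z) \<longlonglongrightarrow> c"
      using right_composition_tendsto_on_ball[of s r gs \<zeta>] s hol_r gs_trap by blast
    have "converges_locally_uniformly (right_composition gs) (\<lambda>_. c)"
    proof (rule locally_uniform_if_tendsto_const_on_open)
      show "right_composition gs n holomorphic_on unit_disc"
        and "right_composition gs n ` unit_disc \<subseteq> unit_disc" for n
        using right_composition_self_map[of gs unit_disc] hol self by blast+
      show "ball \<zeta> s \<subseteq> unit_disc"
        using s_disc ball_subset_cball by blast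
    qed (use s lim in auto)
    then show "\<exists>c\<in>unit_disc. converges_locally_uniformly (right_composition gs) (\<lambda>_. c)"
      using c s_disc by blast
  qed
qed

end
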